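(* Let $f\colon X\to Z$ be a continuous map and let $g\colon Y\to Z$ be a surjective Hurewicz fibration. Then $$\mathrm{TC}(f,g)\le \mathrm{TC}(f).$$ In particular, whenever $\mathrm{TC}(f)$ is finite, so is $\mathrm{TC}(f,g)$.
   Context: All maps are continuous, $I=[0,1]$, and path spaces $X^I$ carry the compact-open topology. For a map $p\colon E\to B$, the sectional number $\mathrm{sec}(p)$ is the least integer $k\ge 0$ such that $B$ has an open cover $U_0,\dots,U_k$ with continuous maps $s_i\colon U_i\to E$ satisfying $p\circ s_i=\mathrm{inc}_{U_i}$ (strict equality); $\mathrm{sec}(p)=\infty$ if no such $k$ exists. For maps $f\colon X\to Z$, $g\colon Y\to Z$ put $\Delta^I_{f,g}=\{(\alpha,\beta)\in X^I\times Y^I : f\circ\alpha=g\circ\beta\}$ and $\pi_{f,g}\colon\Delta^I_{f,g}\to X\times Y$, $\pi_{f,g}(\alpha,\beta)=(\alpha(0),\beta(1))$. The bivariate topological complexity is $\mathrm{TC}(f,g):=\mathrm{sec}(\pi_{f,g})$. For a single map $f\colon X\to Z$, $\mathrm{TC}(f):=\mathrm{sec}(\pi_f)$, where $\pi_f\colon X^I\to X\times Z$, $\pi_f(\alpha)=(\alpha(0),f(\alpha(1)))$. *)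

theory Defs
  imports "HOL-Analysis.Analysis" "HOL-Library.Extended_Nat"
begin

abbreviation unit_interval :: "real topology" where
  "unit_interval \<equiv> top_of_set {0..1}"

text \<open>The paths are the continuous maps restricted to the unit interval in the sense of
  \<^const>\<open>extensional\<close> (value \<^const>\<open>undefined\<close> outside), so that two paths are equal
  iff they agree on the unit interval.\<close>

definition paths_in :: "'a topology \<Rightarrow> (real \<Rightarrow> 'a) set" where
  "paths_in X = {\<alpha> \<in> extensional {0..1}. continuous_map unit_interval X \<alpha>}"

text \<open>The compact-open topology, given by its standard subbasis. The choice \<open>K = {}\<close> gives the
  whole set of paths, so no path is lost in the underlying set of the generated topology.\<close>

definition path_space :: "'a topology \<Rightarrow> (real \<Rightarrow> 'a) topology" where
  "path_space X = topology_generated_by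
     {{\<alpha> \<in> paths_in X. \<alpha> ` K \<subseteq> U} | K U. compactin unit_interval K \<and> openin X U}"

definition has_sectional_cover ::
    "'e topology \<Rightarrow> 'b topology \<Rightarrow> ('e \<Rightarrow> 'b) \<Rightarrow> nat \<Rightarrow> bool" where
  "has_sectional_cover E B p k \<longleftrightarrow>
     (\<exists>(U :: nat \<Rightarrow> 'b set) (s :: nat \<Rightarrow> 'b \<Rightarrow> 'e).
        (\<forall>i\<le>k. openin B (U i) \<and> continuous_map (subtopology B (U i)) E (s i) \<and>
               (\<forall>b\<in>U i. p (s i b) = b)) \<and>
        (\<Union>i\<le>k. U i) = topspace B)"

text \<open>In \<^typ>\<open>enat\<close> the infimum of a nonempty set is its least element, and the infimum of the
  empty set is \<open>\<infinity>\<close>.\<close>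

definition sectional_number :: "'e topology \<Rightarrow> 'b topology \<Rightarrow> ('e \<Rightarrow> 'b) \<Rightarrow> enat" where
  "sectional_number E B p = Inf {enat k | k. has_sectional_cover E B p k}"

definition bivariate_path_space ::
    "'x topology \<Rightarrow> 'y topology \<Rightarrow> ('x \<Rightarrow> 'z) \<Rightarrow> ('y \<Rightarrow> 'z) \<Rightarrow>
     ((real \<Rightarrow> 'x) \<times> (real \<Rightarrow> 'y)) topology" where
  "bivariate_path_space X Y f g =
     subtopology (prod_topology (path_space X) (path_space Y))
       {(\<alpha>, \<beta>). \<forall>t\<in>{0..1}. f (\<alpha> t) = g (\<beta> t)}"

definition bivariate_TC ::
    "'x topology \<Rightarrow> 'y topology \<Rightarrow> ('x \<Rightarrow> 'z) \<Rightarrow> ('y \<Rightarrow> 'z) \<Rightarrow> enat" where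
  "bivariate_TC X Y f g =
     sectional_number (bivariate_path_space X Y f g) (prod_topology X Y) (\<lambda>(\<alpha>, \<beta>). (\<alpha> 0, \<beta> 1))"

definition map_TC :: "'x topology \<Rightarrow> 'z topology \<Rightarrow> ('x \<Rightarrow> 'z) \<Rightarrow> enat" where
  "map_TC X Z f =
     sectional_number (path_space X) (prod_topology X Z) (\<lambda>\<alpha>. (\<alpha> 0, f (\<alpha> 1)))"

definition homotopy_lifting_property ::
    "'w topology \<Rightarrow> 'e topology \<Rightarrow> 'b topology \<Rightarrow> ('e \<Rightarrow> 'b) \<Rightarrow> bool" where
  "homotopy_lifting_property W E B p \<longleftrightarrow>
     (\<forall>h k. continuous_map (prod_topology W unit_interval) B h \<and> continuous_map W E k \<and>
            (\<forall>w\<in>topspace W. p (k w) = h (w, 0)) \<longrightarrow>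
        (\<exists>H. continuous_map (prod_topology W unit_interval) E H \<and>
             (\<forall>w\<in>topspace W. H (w, 0) = k w) \<and>
             (\<forall>w\<in>topspace W. \<forall>t\<in>{0..1}. p (H (w, t)) = h (w, t))))"

text \<open>A Hurewicz fibration has the homotopy lifting property for all spaces. HOL cannot quantify
  over all types inside a definition, so \<open>W\<close> ranges over all topologies on one type, which is
  large enough to carry the universal test space of pairs of a point of \<open>E\<close> and a path in \<open>B\<close>
  starting at its image. Lemma \<open>hurewicz_fibration_HLP\<close> below shows that the lifting property
  then holds for spaces of every type, so nothing is lost.\<close>

definition hurewicz_fibration :: "'e topology \<Rightarrow> 'b topology \<Rightarrow> ('e \<Rightarrow> 'b) \<Rightarrow> bool" where
  "hurewicz_fibration E B p \<longleftrightarrow>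
     continuous_map E B p \<and>
     (\<forall>W :: ('e \<times> (real \<Rightarrow> 'b)) topology. homotopy_lifting_property W E B p)"

lemma topspace_path_space [simp]: "topspace (path_space X) = paths_in X"
proof -
  have "paths_in X \<in> {{\<alpha> \<in> paths_in X. \<alpha> ` K \<subseteq> U} | K U. compactin unit_interval K \<and> openin X U}"
    by (rule CollectI, rule exI[of _ "{}"], rule exI[of _ "{}"]) auto
  then show ?thesis
    unfolding path_space_def topology_generated_by_topspace by blast
qed

lemma continuous_map_path_eval:
  "continuous_map (prod_topology (path_space X) unit_interval) X (\<lambda>(\<alpha>, t). \<alpha> t)"
proof -
  have nb: "neighbourhood_base_of (compactin unit_interval) unit_interval"
    by (intro locally_compact_imp_neighbourhood_base compact_imp_locally_compact_space
        regular_space_subtopology)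
      (auto simp: compact_space_subtopology metrizable_imp_regular_space metrizable_space_euclidean)
  have mem: "\<alpha> t \<in> topspace X" if "\<alpha> \<in> paths_in X" "t \<in> {0..1}" for \<alpha> t
    using that by (auto simp: paths_in_def continuous_map_def)
  have "\<exists>V. openin (prod_topology (path_space X) unit_interval) V \<and> z \<in> V \<and>
          V \<subseteq> {z \<in> topspace (prod_topology (path_space X) unit_interval). (\<lambda>(\<alpha>, t). \<alpha> t) z \<in> U}"
    if U: "openin X U" and z: "z \<in> topspace (prod_topology (path_space X) unit_interval)"
      and zU: "(\<lambda>(\<alpha>, t). \<alpha> t) z \<in> U" for U z
  proof -
    obtain \<alpha> t where zz: "z = (\<alpha>, t)" and \<alpha>: "\<alpha> \<in> paths_in X" and t: "t \<in> {0..1}" "\<alpha> t \<in> U"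
      using z zU by auto
    have "openin unit_interval {t \<in> topspace unit_interval. \<alpha> t \<in> U}"
      by (rule openin_continuous_map_preimage[OF _ U]) (use \<alpha> in \<open>simp add: paths_in_def\<close>)
    then obtain N K where N: "openin unit_interval N" "compactin unit_interval K" "t \<in> N" "N \<subseteq> K"
        "K \<subseteq> {t \<in> topspace unit_interval. \<alpha> t \<in> U}"
      using nb t unfolding neighbourhood_base_of
      by (smt (verit, best) mem_Collect_eq topspace_euclidean_subtopology)
    have op: "openin (path_space X) {\<beta> \<in> paths_in X. \<beta> ` K \<subseteq> U}"
      unfolding path_space_def by (rule topology_generated_by_Basis) (use N U in blast)
    show ?thesis
    proof (intro exI conjI)
      show "openin (prod_topology (path_space X) unit_interval) ({\<beta> \<in> paths_in X. \<beta> ` K \<subseteq> U} \<times> N)"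
        using op N by (simp add: openin_prod_Times_iff)
      show "z \<in> {\<beta> \<in> paths_in X. \<beta> ` K \<subseteq> U} \<times> N"
        using zz \<alpha> N by auto
      show "{\<beta> \<in> paths_in X. \<beta> ` K \<subseteq> U} \<times> N \<subseteq>
          {z \<in> topspace (prod_topology (path_space X) unit_interval). (\<lambda>(\<alpha>, t). \<alpha> t) z \<in> U}"
        using N by auto
    qed
  qed
  then have "openin (prod_topology (path_space X) unit_interval)
      {z \<in> topspace (prod_topology (path_space X) unit_interval). (\<lambda>(\<alpha>, t). \<alpha> t) z \<in> U}"
    if "openin X U" for U
    using that by (subst openin_subopen) blast
  moreover have "(\<lambda>(\<alpha>, t). \<alpha> t) \<in> topspace (prod_topology (path_space X) unit_interval) \<rightarrow> topspace X"
    using mem by auto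
  ultimately show ?thesis
    unfolding continuous_map_def by blast
qed

lemma continuous_map_path_curry:
  assumes h: "continuous_map (prod_topology W unit_interval) X h"
  shows "continuous_map W (path_space X) (\<lambda>w. \<lambda>t\<in>{0..1}. h (w, t))"
proof -
  have path: "(\<lambda>t\<in>{0..1}. h (w, t)) \<in> paths_in X" if "w \<in> topspace W" for w
  proof -
    have "continuous_map unit_interval (prod_topology W unit_interval) (\<lambda>t. (w, t))"
      using that by (intro continuous_map_pairedI) auto
    then have "continuous_map unit_interval X (h \<circ> (\<lambda>t. (w, t)))"
      using h by (rule continuous_map_compose)
    then have "continuous_map unit_interval X (\<lambda>t\<in>{0..1}. h (w, t))"
      by (rule continuous_map_eq) auto
    then show ?thesis by (simp add: paths_in_def)
  qed
  let ?c = "\<lambda>w. \<lambda>t\<in>{0..1}. h (w, t)"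
  have "openin W (?c -` {\<alpha> \<in> paths_in X. \<alpha> ` K \<subseteq> U} \<inter> topspace W)"
    if K: "compactin unit_interval K" and U: "openin X U" for K U
  proof (subst openin_subopen, intro ballI)
    fix w assume w: "w \<in> ?c -` {\<alpha> \<in> paths_in X. \<alpha> ` K \<subseteq> U} \<inter> topspace W"
    have K01: "K \<subseteq> {0..1}"
      using compactin_subset_topspace[OF K] by simp
    have op: "openin (prod_topology W unit_interval)
        {z \<in> topspace (prod_topology W unit_interval). h z \<in> U}"
      using h U by (rule openin_continuous_map_preimage)
    have "h (w, t) \<in> U" if "t \<in> K" for t
    proof -
      have "?c w ` K \<subseteq> U" using w by blast
      then have "?c w t \<in> U" using that by blast
      then show ?thesis using that K01 by auto
    qed
    then have sub: "{w} \<times> K \<subseteq> {z \<in> topspace (prod_topology W unit_interval). h z \<in> U}"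
      using w K01 by auto
    obtain A B where AB: "openin W A" "w \<in> A" "K \<subseteq> B"
        "A \<times> B \<subseteq> {z \<in> topspace (prod_topology W unit_interval). h z \<in> U}"
      using tube_lemma_right[OF op K _ sub] w by blast
    have "A \<subseteq> ?c -` {\<alpha> \<in> paths_in X. \<alpha> ` K \<subseteq> U} \<inter> topspace W"
    proof
      fix v assume v: "v \<in> A"
      then have vW: "v \<in> topspace W" using AB openin_subset by blast
      have "?c v ` K \<subseteq> U" using v AB K01 by auto
      then show "v \<in> ?c -` {\<alpha> \<in> paths_in X. \<alpha> ` K \<subseteq> U} \<inter> topspace W"
        using vW path[OF vW] by blast
    qed
    with AB show "\<exists>T. openin W T \<and> w \<in> T \<and>
        T \<subseteq> ?c -` {\<alpha> \<in> paths_in X. \<alpha> ` K \<subseteq> U} \<inter> topspace W"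
      by blast
  qed
  moreover have "?c ` topspace W \<subseteq> topspace (path_space X)"
    using path by auto
  ultimately show ?thesis
    unfolding path_space_def topology_generated_by_topspace
    by (intro continuous_on_generated_topo) blast+
qed

lemma hurewicz_fibration_HLP:
  fixes W :: "'w topology"
  assumes "hurewicz_fibration E B p"
  shows "homotopy_lifting_property W E B p"
  unfolding homotopy_lifting_property_def
proof (intro allI impI, elim conjE)
  fix h k
  assume h: "continuous_map (prod_topology W unit_interval) B h"
    and k: "continuous_map W E k"
    and hk: "\<forall>w\<in>topspace W. p (k w) = h (w, 0)"
  define P where "P = subtopology (prod_topology E (path_space B)) {(e, \<gamma>). p e = \<gamma> 0}"
  have cfst: "continuous_map P E fst"
    unfolding P_def by (intro continuous_map_from_subtopology continuous_map_fst)
  have csnd: "continuous_map P (path_space B) snd"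
    unfolding P_def by (intro continuous_map_from_subtopology continuous_map_snd)
  have "continuous_map (prod_topology P unit_interval) (prod_topology (path_space B) unit_interval)
      (\<lambda>z. (snd (fst z), snd z))"
    using continuous_map_compose[OF continuous_map_fst csnd]
    by (intro continuous_map_pairedI continuous_map_snd) (simp add: o_def)
  from continuous_map_compose[OF this continuous_map_path_eval]
  have ev: "continuous_map (prod_topology P unit_interval) B (\<lambda>z. snd (fst z) (snd z))"
    by (simp add: o_def)
  have "homotopy_lifting_property P E B p"
    using assms by (auto simp: hurewicz_fibration_def)
  then obtain H where H: "continuous_map (prod_topology P unit_interval) E H"
      "\<forall>w\<in>topspace P. H (w, 0) = fst w"
      "\<forall>w\<in>topspace P. \<forall>t\<in>{0..1}. p (H (w, t)) = snd w t"
    using ev cfst unfolding homotopy_lifting_property_def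
    by (elim allE[of _ "\<lambda>z. snd (fst z) (snd z)"] allE[of _ fst]) (auto simp: P_def)
  define \<phi> where "\<phi> w = (k w, \<lambda>t\<in>{0..1}. h (w, t))" for w
  have \<phi>: "continuous_map W P \<phi>"
    unfolding P_def
  proof (rule continuous_map_into_subtopology)
    show "continuous_map W (prod_topology E (path_space B)) \<phi>"
      unfolding \<phi>_def by (intro continuous_map_pairedI k continuous_map_path_curry[OF h])
  qed (auto simp: \<phi>_def hk)
  have \<phi>P: "\<phi> w \<in> topspace P" if "w \<in> topspace W" for w
    using \<phi> that by (auto simp: continuous_map_def)
  have "continuous_map (prod_topology W unit_interval) (prod_topology P unit_interval)
      (\<lambda>z. (\<phi> (fst z), snd z))"
    using continuous_map_compose[OF continuous_map_fst \<phi>]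
    by (intro continuous_map_pairedI continuous_map_snd) (simp add: o_def)
  from continuous_map_compose[OF this H(1)]
  have "continuous_map (prod_topology W unit_interval) E (\<lambda>z. H (\<phi> (fst z), snd z))"
    by (simp add: o_def)
  moreover have "\<forall>w\<in>topspace W. H (\<phi> w, 0) = k w"
    using H(2) \<phi>P by (auto simp: \<phi>_def)
  moreover have "\<forall>w\<in>topspace W. \<forall>t\<in>{0..1}. p (H (\<phi> w, t)) = h (w, t)"
    using H(3) \<phi>P by (auto simp: \<phi>_def)
  ultimately show "\<exists>H. continuous_map (prod_topology W unit_interval) E H \<and>
      (\<forall>w\<in>topspace W. H (w, 0) = k w) \<and>
      (\<forall>w\<in>topspace W. \<forall>t\<in>{0..1}. p (H (w, t)) = h (w, t))"
    by (intro exI[of _ "\<lambda>z. H (\<phi> (fst z), snd z)"]) auto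
qed

end

theory Submission
  imports Defs
begin

text \<open>A section of \<open>\<pi>\<^sub>f\<close> over an open set \<open>U\<close> of \<open>X \<times> Z\<close> assigns to \<open>(x, z)\<close> a path \<open>\<alpha>\<close> in \<open>X\<close>
  from \<open>x\<close> to some point over \<open>z\<close>. Pull it back along \<open>id \<times> g\<close> to the open set of all \<open>(x, y)\<close>
  with \<open>(x, g y) \<in> U\<close>: now \<open>f \<circ> \<alpha>\<close> is a path in \<open>Z\<close> that ends at \<open>g y\<close>. The homotopy lifting
  property of \<open>g\<close>, applied to the reversed paths with initial points \<open>y\<close>, lifts all of them
  simultaneously and continuously to paths \<open>\<beta>\<close> in \<open>Y\<close> that end at \<open>y\<close>
  (\<open>hurewicz_fibration_lift_path_family\<close>). The pairs \<open>(\<alpha>, \<beta>)\<close> form a section of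
  \<open>\<pi>\<^bsub>f,g\<^esub>\<close>, so a sectional cover for \<open>\<pi>\<^sub>f\<close> yields one of the same size for
  \<open>\<pi>\<^bsub>f,g\<^esub>\<close>.\<close>

text \<open>The lifting property prescribes a lift at time \<open>0\<close>, whereas here the end of each lifted path is
  prescribed; hence \<open>t \<mapsto> 1 - t\<close> is applied before and after lifting.\<close>

lemma hurewicz_fibration_lift_path_family:
  assumes f: "continuous_map X Z f"
    and g: "hurewicz_fibration Y Z g"
    and a: "continuous_map W (path_space X) a"
    and k: "continuous_map W Y k"
    and end_eq: "\<And>w. w \<in> topspace W \<Longrightarrow> g (k w) = f (a w 1)"
  obtains b where "continuous_map W (path_space Y) b"
    and "\<And>w. w \<in> topspace W \<Longrightarrow> b w 1 = k w"
    and "\<And>w t. \<lbrakk>w \<in> topspace W; t \<in> {0..1}\<rbrakk> \<Longrightarrow> g (b w t) = f (a w t)"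
proof -
  have rev: "continuous_map (prod_topology W unit_interval) unit_interval (\<lambda>z. 1 - snd z)"
  proof -
    have "continuous_map unit_interval unit_interval (\<lambda>t. 1 - t)"
      by (auto simp: continuous_map_in_subtopology intro!: continuous_intros)
    from continuous_map_compose[OF continuous_map_snd this] show ?thesis
      by (simp add: o_def)
  qed
  have "continuous_map (prod_topology W unit_interval)
      (prod_topology (path_space X) unit_interval) (\<lambda>z. (a (fst z), 1 - snd z))"
    using continuous_map_compose[OF continuous_map_fst a]
    by (intro continuous_map_pairedI rev) (simp add: o_def)
  from continuous_map_compose[OF continuous_map_compose[OF this continuous_map_path_eval] f]
  have h: "continuous_map (prod_topology W unit_interval) Z (\<lambda>z. f (a (fst z) (1 - snd z)))"
    by (simp add: o_def)
  have "homotopy_lifting_property W Y Z g"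
    by (rule hurewicz_fibration_HLP[OF g])
  with h k end_eq obtain H where H: "continuous_map (prod_topology W unit_interval) Y H"
    and H0: "\<And>w. w \<in> topspace W \<Longrightarrow> H (w, 0) = k w"
    and gH: "\<And>w t. \<lbrakk>w \<in> topspace W; t \<in> {0..1}\<rbrakk> \<Longrightarrow> g (H (w, t)) = f (a w (1 - t))"
    unfolding homotopy_lifting_property_def
    by (elim allE[of _ "\<lambda>z. f (a (fst z) (1 - snd z))"] allE[of _ k]) auto
  have "continuous_map (prod_topology W unit_interval) (prod_topology W unit_interval)
      (\<lambda>z. (fst z, 1 - snd z))"
    by (intro continuous_map_pairedI continuous_map_fst rev)
  from continuous_map_compose[OF this H]
  have Hrev: "continuous_map (prod_topology W unit_interval) Y (\<lambda>z. H (fst z, 1 - snd z))"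
    by (simp add: o_def)
  show thesis
  proof (rule that)
    show "continuous_map W (path_space Y) (\<lambda>w. \<lambda>t\<in>{0..1}. H (w, 1 - t))"
      using continuous_map_path_curry[OF Hrev] by simp
  qed (auto simp: H0 gH)
qed

lemma has_sectional_cover_bivariate:
  fixes X :: "'x topology" and Y :: "'y topology" and Z :: "'z topology"
  assumes f: "continuous_map X Z f"
    and g: "hurewicz_fibration Y Z g"
    and cover: "has_sectional_cover (path_space X) (prod_topology X Z) (\<lambda>\<alpha>. (\<alpha> 0, f (\<alpha> 1))) k"
  shows "has_sectional_cover (bivariate_path_space X Y f g) (prod_topology X Y)
           (\<lambda>(\<alpha>, \<beta>). (\<alpha> 0, \<beta> 1)) k"
proof -
  obtain U s where U: "\<And>i. i \<le> k \<Longrightarrow> openin (prod_topology X Z) (U i)"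
    and s: "\<And>i. i \<le> k \<Longrightarrow>
        continuous_map (subtopology (prod_topology X Z) (U i)) (path_space X) (s i)"
    and s_end: "\<And>i b. \<lbrakk>i \<le> k; b \<in> U i\<rbrakk> \<Longrightarrow> (s i b 0, f (s i b 1)) = b"
    and U_cover: "(\<Union>i\<le>k. U i) = topspace (prod_topology X Z)"
    using cover unfolding has_sectional_cover_def by blast
  have gc: "continuous_map Y Z g"
    using g by (simp add: hurewicz_fibration_def)
  define \<phi> :: "'x \<times> 'y \<Rightarrow> 'x \<times> 'z" where "\<phi> = (\<lambda>w. (fst w, g (snd w)))"
  have \<phi>: "continuous_map (prod_topology X Y) (prod_topology X Z) \<phi>"
    using continuous_map_compose[OF continuous_map_snd gc] unfolding \<phi>_def
    by (intro continuous_map_pairedI continuous_map_fst) (simp add: o_def)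
  define V where "V i = {w \<in> topspace (prod_topology X Y). \<phi> w \<in> U i}" for i
  have V: "openin (prod_topology X Y) (V i)" if "i \<le> k" for i
    unfolding V_def by (rule openin_continuous_map_preimage[OF \<phi> U[OF that]])
  have ex: "\<exists>\<sigma>. continuous_map (subtopology (prod_topology X Y) (V i))
                (bivariate_path_space X Y f g) \<sigma> \<and>
              (\<forall>w\<in>V i. (\<lambda>(\<alpha>, \<beta>). (\<alpha> 0, \<beta> 1)) (\<sigma> w) = w)"
    if i: "i \<le> k" for i
  proof -
    let ?W = "subtopology (prod_topology X Y) (V i)"
    have tW: "topspace ?W = V i"
      by (auto simp: V_def)
    have "continuous_map ?W (subtopology (prod_topology X Z) (U i)) \<phi>"
      by (intro continuous_map_into_subtopology continuous_map_from_subtopology \<phi>)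
        (auto simp: V_def)
    from continuous_map_compose[OF this s[OF i]]
    have a: "continuous_map ?W (path_space X) (\<lambda>w. s i (\<phi> w))"
      by (simp add: o_def)
    have \<phi>_end: "(s i (\<phi> w) 0, f (s i (\<phi> w) 1)) = \<phi> w" if "w \<in> V i" for w
      using s_end[OF i] that by (simp add: V_def)
    have y: "continuous_map ?W Y snd"
      by (intro continuous_map_from_subtopology continuous_map_snd)
    obtain b where b: "continuous_map ?W (path_space Y) b"
      and b1: "\<And>w. w \<in> topspace ?W \<Longrightarrow> b w 1 = snd w"
      and gb: "\<And>w t. \<lbrakk>w \<in> topspace ?W; t \<in> {0..1}\<rbrakk> \<Longrightarrow> g (b w t) = f (s i (\<phi> w) t)"
    proof (rule hurewicz_fibration_lift_path_family[OF f g a y])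
      fix w assume "w \<in> topspace ?W"
      then show "g (snd w) = f (s i (\<phi> w) 1)"
        using \<phi>_end[of w] unfolding tW by (simp add: \<phi>_def)
    qed blast
    have "continuous_map ?W (bivariate_path_space X Y f g) (\<lambda>w. (s i (\<phi> w), b w))"
      unfolding bivariate_path_space_def
      by (intro continuous_map_into_subtopology continuous_map_pairedI a b) (auto simp: gb)
    moreover have "(s i (\<phi> w) 0, b w 1) = w" if "w \<in> V i" for w
      using \<phi>_end[OF that] b1[of w] that unfolding tW by (simp add: \<phi>_def prod_eq_iff)
    ultimately show ?thesis
      by (intro exI[of _ "\<lambda>w. (s i (\<phi> w), b w)"]) auto
  qed
  then obtain \<sigma> where \<sigma>: "\<And>i. i \<le> k \<Longrightarrow>
      continuous_map (subtopology (prod_topology X Y) (V i)) (bivariate_path_space X Y f g) (\<sigma> i) \<and>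
      (\<forall>w\<in>V i. (\<lambda>(\<alpha>, \<beta>). (\<alpha> 0, \<beta> 1)) (\<sigma> i w) = w)"
    by metis
  have "\<phi> w \<in> (\<Union>i\<le>k. U i)" if "w \<in> topspace (prod_topology X Y)" for w
    unfolding U_cover using \<phi> that by (auto simp: continuous_map_def)
  then have "(\<Union>i\<le>k. V i) = topspace (prod_topology X Y)"
    unfolding V_def by blast
  with V \<sigma> show ?thesis
    unfolding has_sectional_cover_def by blast
qed

theorem theorem4p1:
  fixes X :: "'x topology" and Y :: "'y topology" and Z :: "'z topology"
    and f :: "'x \<Rightarrow> 'z" and g :: "'y \<Rightarrow> 'z"
  assumes "continuous_map X Z f"
    and "hurewicz_fibration Y Z g"
    and "g ` topspace Y = topspace Z"
  shows "bivariate_TC X Y f g \<le> map_TC X Z f \<and>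
         (map_TC X Z f < \<infinity> \<longrightarrow> bivariate_TC X Y f g < \<infinity>)"
proof -
  have "bivariate_TC X Y f g \<le> map_TC X Z f"
    unfolding bivariate_TC_def map_TC_def sectional_number_def
    by (rule Inf_superset_mono) (use has_sectional_cover_bivariate[OF assms(1,2)] in blast)
  then show ?thesis
    using le_less_trans by blast
qed

end
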